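(* Let $k,t$ be positive integers with $t\le k-1$. Let $\mathcal{A}$ be a MIF$(k-t)$ and let $\mathcal{F}$ be a CIF$(k,t)$, where $\mathcal{A}$ and $\mathcal{F}$ have disjoint point sets. Then $\mathcal{F}\sqcup(\mathcal{A}\circledast\mathcal{F}^{\top})$ is a MIF$(k)$.
   Context: A family is a non-empty set of non-empty finite sets, called its blocks. The point set of a family $\mathcal{G}$ is $P_{\mathcal{G}}=\bigcup_{B\in\mathcal{G}}B$. A family is uniform if all its blocks have the same size, denoted $\mathrm{k}(\mathcal{G})$. A blocking set of $\mathcal{G}$ is a set meeting every block of $\mathcal{G}$. If $\mathcal{G}$ has a finite blocking set, $\mathrm{tr}(\mathcal{G})$ is the smallest size of a blocking set, a transversal is a blocking set of size $\mathrm{tr}(\mathcal{G})$, and $\mathcal{G}^{\top}$ is the family of all transversals of $\mathcal{G}$; otherwise $\mathrm{tr}(\mathcal{G})=\infty$. The symbol $\sqcup$ denotes disjoint union (of sets or of families). If $P_{\mathcal{G}}\cap P_{\mathcal{H}}=\emptyset$, then $\mathcal{G}\circledast\mathcal{H}=\{A\sqcup B: A\in\mathcal{G},B\in\mathcal{H}\}$. A MIF$(k)$ is a uniform family $\mathcal{F}$ with $\mathrm{k}(\mathcal{F})=k$, $\mathrm{tr}(\mathcal{F})<\infty$ and $\mathcal{F}=\mathcal{F}^{\top}$. A CIF$(k,t)$ is a uniform family $\mathcal{F}$ with $\mathrm{k}(\mathcal{F})=k$, $\mathrm{tr}(\mathcal{F})=t\le k-1$ and $\mathcal{F}=(\mathcal{F}\sqcup\mathcal{F}^{\top})^{\top}$.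 *)

theory Defs
  imports Main "HOL-Library.Extended_Nat"
begin

definition is_family :: "'a set set \<Rightarrow> bool" where
  "is_family G \<longleftrightarrow> G \<noteq> {} \<and> (\<forall>B\<in>G. finite B \<and> B \<noteq> {})"

definition points :: "'a set set \<Rightarrow> 'a set" where
  "points G = (\<Union>B\<in>G. B)"

definition uniform_family :: "'a set set \<Rightarrow> bool" where
  "uniform_family G \<longleftrightarrow> is_family G \<and> (\<forall>A\<in>G. \<forall>B\<in>G. card A = card B)"

(* Only meaningful for uniform families. *)
definition block_size :: "'a set set \<Rightarrow> nat" where
  "block_size G = (THE k. \<forall>B\<in>G. card B = k)"

(* A blocking set may be infinite and need not be contained in the point set. *)
definition blocking_set :: "'a set set \<Rightarrow> 'a set \<Rightarrow> bool" where
  "blocking_set G S \<longleftrightarrow> (\<forall>B\<in>G. S \<inter> B \<noteq> {})"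

definition tr :: "'a set set \<Rightarrow> enat" where
  "tr G = (if \<exists>S. finite S \<and> blocking_set G S
           then enat (LEAST n. \<exists>S. finite S \<and> blocking_set G S \<and> card S = n)
           else \<infinity>)"

(* Empty if tr G = \<infinity>, since blocking sets are required to be finite here. *)
definition transversals :: "'a set set \<Rightarrow> 'a set set" where
  "transversals G = {S. finite S \<and> blocking_set G S \<and> enat (card S) = tr G}"

(* Intended for families with disjoint point sets; then every union below is disjoint. *)
definition family_prod :: "'a set set \<Rightarrow> 'a set set \<Rightarrow> 'a set set" (infixl "\<circledast>" 70) where
  "G \<circledast> H = {A \<union> B | A B. A \<in> G \<and> B \<in> H}"

definition MIF :: "nat \<Rightarrow> 'a set set \<Rightarrow> bool" where
  "MIF k F \<longleftrightarrow> uniform_family F \<and> block_size F = k \<and> tr F < \<infinity> \<and> F = transversals F"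

(* "t < k" is "t \<le> k - 1" without truncated subtraction. It makes the union of F and
   its transversals disjoint: blocks of F have size k, transversals have size t. *)
definition CIF :: "nat \<Rightarrow> nat \<Rightarrow> 'a set set \<Rightarrow> bool" where
  "CIF k t F \<longleftrightarrow> uniform_family F \<and> block_size F = k \<and> tr F = enat t \<and> t < k \<and>
     F = transversals (F \<union> transversals F)"

end

theory Submission
  imports Defs
begin

text \<open>Every block of the new family meets every other one, so its blocking number is at most \<open>k\<close>.
  Conversely let \<open>C\<close> be a blocking set with at most \<open>k\<close> points. If \<open>C\<close> meets all transversals
  of \<open>\<F>\<close>, then \<open>C\<close> is a transversal of \<open>\<F>\<close> together with its transversals, hence
  \<open>C \<in> \<F>\<close>. If \<open>C\<close> misses some transversal \<open>S\<close>, then it must meet every \<open>A \<union> S\<close> inside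
  \<open>A\<close>, so it blocks both \<open>\<A>\<close> and \<open>\<F>\<close>; as this already needs \<open>(k - t) + t\<close>
  points, \<open>C\<close> is the union of a transversal of \<open>\<A>\<close> and one of \<open>\<F>\<close>.\<close>

lemma tr_le_card:
  assumes "finite S" "blocking_set G S"
  shows "tr G \<le> enat (card S)"
  using assms unfolding tr_def by (auto intro: Least_le)

text \<open>A finite \<open>tr G\<close> is the least element of a non-empty set of sizes, so some
  finite blocking set attains it.\<close>

lemma transversals_nonempty:
  assumes "tr G < \<infinity>"
  shows "transversals G \<noteq> {}"
proof -
  have ex: "\<exists>S. finite S \<and> blocking_set G S"
    using assms unfolding tr_def by (auto split: if_splits)
  then have "\<exists>n S. finite S \<and> blocking_set G S \<and> card S = n" by blast
  from LeastI_ex[OF this] ex show ?thesis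
    unfolding transversals_def tr_def by auto
qed

lemma transversal_if_card_le:
  assumes "finite S" "blocking_set G S" "enat (card S) \<le> tr G"
  shows "S \<in> transversals G"
  using assms tr_le_card[of S G] unfolding transversals_def by auto

lemma blocking_set_Int_points:
  "blocking_set G (S \<inter> points G) \<longleftrightarrow> blocking_set G S"
  unfolding blocking_set_def points_def by blast

lemma blocking_set_Un:
  "blocking_set (G \<union> H) S \<longleftrightarrow> blocking_set G S \<and> blocking_set H S"
  unfolding blocking_set_def by blast

text \<open>Cutting a transversal down to the point set keeps it blocking, so by minimality no point
  can be lost.\<close>

lemma transversal_subset_points:
  assumes "S \<in> transversals G"
  shows "S \<subseteq> points G"
proof -
  have fin: "finite S" and "blocking_set G S" and card: "enat (card S) = tr G"
    using assms by (auto simp: transversals_def)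
  then have "tr G \<le> enat (card (S \<inter> points G))"
    by (intro tr_le_card) (auto simp: blocking_set_Int_points)
  then have "card S \<le> card (S \<inter> points G)"
    unfolding card[symmetric] by simp
  then have "S \<inter> points G = S"
    using fin by (intro card_seteq) auto
  then show ?thesis by blast
qed

lemma card_block:
  assumes "uniform_family G" "B \<in> G"
  shows "card B = block_size G"
proof -
  have same: "\<forall>A\<in>G. card A = card B" using assms unfolding uniform_family_def by blast
  have "block_size G = card B"
    unfolding block_size_def
  proof (rule the_equality)
    show "\<forall>A\<in>G. card A = card B" by (rule same)
  next
    fix n assume "\<forall>A\<in>G. card A = n"
    then show "n = card B" using assms(2) by simp
  qed
  then show ?thesis by simp
qed

text \<open>This criterion avoids computing \<open>tr G\<close> beforehand. Any block shows
  \<open>tr G \<le> k\<close>, so \<open>maximal\<close> makes every transversal a block.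
  Transversals then have \<open>k\<close> points, which gives \<open>tr G = k\<close> and turns
  every block into a transversal.\<close>

lemma MIF_I:
  assumes fam: "is_family G"
    and card: "\<And>B. B \<in> G \<Longrightarrow> card B = k"
    and intersecting: "\<And>B. B \<in> G \<Longrightarrow> blocking_set G B"
    and maximal: "\<And>C. finite C \<Longrightarrow> blocking_set G C \<Longrightarrow> card C \<le> k \<Longrightarrow> C \<in> G"
  shows "MIF k G"
proof -
  have unif: "uniform_family G" using fam card by (simp add: uniform_family_def)
  obtain B where B: "B \<in> G" using fam by (auto simp: is_family_def)
  have fin: "\<And>B. B \<in> G \<Longrightarrow> finite B" using fam by (simp add: is_family_def)
  have le: "tr G \<le> enat k"
    using tr_le_card[OF fin[OF B] intersecting[OF B]] card[OF B] by simp
  then have tr_fin: "tr G < \<infinity>" by (rule le_less_trans) simp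
  have sub: "transversals G \<subseteq> G"
  proof
    fix S assume "S \<in> transversals G"
    then have "finite S" "blocking_set G S" and eq: "enat (card S) = tr G"
      by (auto simp: transversals_def)
    moreover have "card S \<le> k" using le unfolding eq[symmetric] by simp
    ultimately show "S \<in> G" by (intro maximal)
  qed
  obtain S where S: "S \<in> transversals G"
    using transversals_nonempty[OF tr_fin] by blast
  then have "tr G = enat (card S)" by (simp add: transversals_def)
  then have "tr G = enat k" using S sub card by auto
  then have "transversals G = G"
    using sub fin intersecting card by (auto simp: transversals_def)
  then show ?thesis
    using unif tr_fin card_block[OF unif B] card[OF B] by (simp add: MIF_def)
qed

theorem theorem2p7:
  fixes k t :: nat and \<A> \<F> :: "'a set set"
  assumes "k > 0" and "t > 0" and "t \<le> k - 1"
    and "MIF (k - t) \<A>"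
    and "CIF k t \<F>"
    and "points \<A> \<inter> points \<F> = {}"
  shows "points \<A> \<inter> points (transversals \<F>) = {} \<and>
         \<F> \<inter> (\<A> \<circledast> transversals \<F>) = {} \<and>
         MIF k (\<F> \<union> (\<A> \<circledast> transversals \<F>))"
proof -
  let ?T = "transversals \<F>"
  let ?G = "\<F> \<union> (\<A> \<circledast> ?T)"
  have uA: "uniform_family \<A>" and sizeA: "block_size \<A> = k - t"
    and eqA: "transversals \<A> = \<A>"
    using \<open>MIF (k - t) \<A>\<close> unfolding MIF_def by blast+
  have uF: "uniform_family \<F>" and sizeF: "block_size \<F> = k" and trF: "tr \<F> = enat t"
    and "t < k" and eqF: "transversals (\<F> \<union> ?T) = \<F>"
    using \<open>CIF k t \<F>\<close> unfolding CIF_def by blast+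
  have cardA: "card A = k - t" if "A \<in> \<A>" for A
    using card_block[OF uA that] sizeA by simp
  have cardF: "card B = k" if "B \<in> \<F>" for B
    using card_block[OF uF that] sizeF by simp
  have famA: "\<A> \<noteq> {}" "\<And>A. A \<in> \<A> \<Longrightarrow> finite A \<and> A \<noteq> {}"
    using uA by (auto simp: uniform_family_def is_family_def)
  have famF: "\<F> \<noteq> {}" "\<And>B. B \<in> \<F> \<Longrightarrow> finite B \<and> B \<noteq> {}"
    using uF by (auto simp: uniform_family_def is_family_def)
  have T: "finite S" "card S = t" "blocking_set \<F> S" "S \<subseteq> points \<F>" if "S \<in> ?T" for S
    using that transversal_subset_points[OF that] trF by (auto simp: transversals_def)
  \<comment> \<open>The hypotheses do not give \<open>tr\<close> of \<open>\<A>\<close> or of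
    \<open>\<F> \<union> ?T\<close> as a number, but the transversals of these families are the
    blocks of \<open>\<A>\<close> and \<open>\<F>\<close>, whose sizes are known.\<close>
  have tr_eq: "tr G = enat n"
    if ne: "transversals G \<noteq> {}" and card: "\<And>S. S \<in> transversals G \<Longrightarrow> card S = n" for G :: "'a set set" and n
  proof -
    obtain S where "S \<in> transversals G" using ne by blast
    then show ?thesis using card[of S] by (simp add: transversals_def)
  qed
  have trA: "tr \<A> = enat (k - t)"
    by (rule tr_eq) (simp_all only: eqA famA cardA not_False_eq_True)
  have trFT: "tr (\<F> \<union> ?T) = enat k"
    by (rule tr_eq) (simp_all only: eqF famF cardF not_False_eq_True)
  have blockA: "blocking_set \<A> A" if "A \<in> \<A>" for A
    using that eqA by (auto simp: transversals_def)
  have blockF: "blocking_set \<F> B" "blocking_set ?T B" if "B \<in> \<F>" for B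
    using that eqF by (auto simp: transversals_def blocking_set_Un)
  have disj: "A \<inter> S = {}" if "A \<in> \<A>" "S \<subseteq> points \<F>" for A S
    using that \<open>points \<A> \<inter> points \<F> = {}\<close> unfolding points_def by blast
  have ptsT: "points ?T \<subseteq> points \<F>"
    using T(4) unfolding points_def by blast
  have disjoint_families: "\<F> \<inter> (\<A> \<circledast> ?T) = {}"
  proof -
    have False if "A \<in> \<A>" "A \<union> S \<in> \<F>" for A S
    proof -
      \<comment> \<open>The contradiction comes from \<open>A\<close> being non-empty and disjoint
        from the points of \<open>\<F>\<close>.\<close>
      have "A \<subseteq> points \<F>" using that(2) unfolding points_def by blast
      then show False using disj[OF that(1)] famA(2)[OF that(1)] by blast
    qed
    then show ?thesis unfolding family_prod_def by blast
  qed
  have "MIF k ?G"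
  proof (rule MIF_I)
    show "is_family ?G"
      using famF famA(2) T(1) unfolding is_family_def family_prod_def by auto
  next
    fix B assume "B \<in> ?G"
    moreover have "card (A \<union> S) = k" if "A \<in> \<A>" "S \<in> ?T" for A S
      using that disj T famA(2) cardA \<open>t < k\<close> by (simp add: card_Un_disjoint)
    ultimately show "card B = k"
      using cardF unfolding family_prod_def by blast
  next
    fix B assume "B \<in> ?G"
    then consider "B \<in> \<F>" | A S where "A \<in> \<A>" "S \<in> ?T" "B = A \<union> S"
      unfolding family_prod_def by blast
    then show "blocking_set ?G B"
    proof cases
      case 1
      \<comment> \<open>The block \<open>B\<close> meets each \<open>A \<union> S\<close> inside
        \<open>S\<close>, because it also blocks \<open>?T\<close>.\<close>
      then show ?thesis
        using blockF[OF 1] unfolding family_prod_def blocking_set_def by blast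
    next
      case 2
      \<comment> \<open>Here \<open>S\<close> meets the blocks of \<open>\<F>\<close>, while
        \<open>A\<close> meets the first component of every block of the product.\<close>
      then show ?thesis
        using blockA[OF 2(1)] T(3)[OF 2(2)] unfolding family_prod_def blocking_set_def by blast
    qed
  next
    fix C assume finC: "finite C" and blC: "blocking_set ?G C" and leC: "card C \<le> k"
    then have blCF: "blocking_set \<F> C" by (simp add: blocking_set_Un)
    show "C \<in> ?G"
    proof (cases "blocking_set ?T C")
      case True
      \<comment> \<open>The bound \<open>card C \<le> k\<close> is exactly
        \<open>tr (\<F> \<union> ?T)\<close>, so \<open>C\<close> has least possible size.\<close>
      then have "C \<in> transversals (\<F> \<union> ?T)"
        using finC blCF leC trFT by (intro transversal_if_card_le) (auto simp: blocking_set_Un)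
      then show ?thesis using eqF by simp
    next
      case False
      then obtain S where S: "S \<in> ?T" "C \<inter> S = {}" unfolding blocking_set_def by blast
      have "blocking_set \<A> C"
        unfolding blocking_set_def
      proof
        fix A assume "A \<in> \<A>"
        then have "A \<union> S \<in> ?G" using S(1) unfolding family_prod_def by blast
        then have "C \<inter> (A \<union> S) \<noteq> {}" using blC unfolding blocking_set_def by blast
        then show "C \<inter> A \<noteq> {}" using S(2) by blast
      qed
      \<comment> \<open>Each part still blocks its own family, and the two point sets are disjoint,
        so the two lower bounds on size add up.\<close>
      define CA where "CA = C \<inter> points \<A>"
      define CF where "CF = C \<inter> points \<F>"
      have fin: "finite CA" "finite CF" using finC by (simp_all add: CA_def CF_def)
      have bl: "blocking_set \<A> CA" "blocking_set \<F> CF"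
        using \<open>blocking_set \<A> C\<close> blCF by (simp_all add: CA_def CF_def blocking_set_Int_points)
      have ge: "k - t \<le> card CA" "t \<le> card CF"
        using tr_le_card[OF fin(1) bl(1)] tr_le_card[OF fin(2) bl(2)] trA trF by simp_all
      have un: "card (CA \<union> CF) = card CA + card CF"
        using fin \<open>points \<A> \<inter> points \<F> = {}\<close>
        by (intro card_Un_disjoint) (auto simp: CA_def CF_def)
      have sub: "CA \<union> CF \<subseteq> C" by (auto simp: CA_def CF_def)
      have "card (CA \<union> CF) \<le> card C" using sub finC by (rule card_mono[rotated])
      \<comment> \<open>As \<open>(k - t) + t = k\<close>, the bounds squeeze
        \<open>card CA + card CF\<close> and \<open>card C\<close> to \<open>k\<close>. Both parts
        are thus of minimal size, and \<open>C\<close> has no further points.\<close>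
      then have eq: "card CA = k - t" "card CF = t" "card C \<le> card (CA \<union> CF)"
        using ge un leC \<open>t < k\<close> by linarith+
      have "CA \<in> transversals \<A>" "CF \<in> ?T"
        using fin bl eq trA trF by (auto intro: transversal_if_card_le)
      moreover have "CA \<union> CF = C" using finC sub eq(3) by (rule card_seteq)
      ultimately show ?thesis using eqA unfolding family_prod_def by blast
    qed
  qed
  then show ?thesis
    using ptsT disjoint_families \<open>points \<A> \<inter> points \<F> = {}\<close> by blast
qed

end
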